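(* Let $E=E(\tau,S)$ be an equation of state satisfying the standing assumptions listed in the context. Suppose that the energy condition $$\int_1^{\infty}p(\tau,S)\,d\tau=\int_0^1\frac{\hat p(\rho,S)}{\rho^2}\,d\rho<+\infty\quad\text{for all }S\in\mathbb{R}$$ holds, and that the following pressure near vacuum condition holds: for some value of $S$ there exist positive numbers $\varepsilon_0,\alpha_0,M_0$ such that $$\hat p_\rho(\rho,S)\le M_0\,\rho^{\alpha_0}\quad\text{whenever }\rho\in(0,\varepsilon_0).$$ Then vacuums exist in the solution of some Riemann problems; that is, there exist Riemann data $(\rho_l,u_l,S_l)$, $(\rho_r,u_r,S_r)$ with $\rho_l,\rho_r>0$ having a Riemann solution that contains a vacuum.
   Context: **Equations.** The Euler equations in one space dimension are $$\rho_t+(\rho u)_x=0,\qquad (\rho u)_t+(\rho u^2+p)_x=0,\qquad (\tfrac12\rho u^2+\rho E)_t+(u(\tfrac12\rho u^2+\rho E+p))_x=0,$$ with density $\rho$, specific volume $\tau=1/\rho$, velocity $u$, specific entropy $S$, specific internal energy $E=E(\tau,S)$, pressure $p=-E_\tau$ and temperature $T=E_S$. Write $\hat p(\rho,S)=p(1/\rho,S)$; the sound speed is $c=\sqrt{\hat p_\rho}$. Define $R(\rho,S)=\int_1^{\rho}\frac{\sqrt{\hat p_\rho(r,S)}}{r}\,dr$. **Standing assumptions on the equation of state.** $E\in C^2$ for $\tau\in(0,\infty)$, $S\in\mathbb{R}$; $p=-E_\tau>0$; $T=E_S\ge0$; $\lim_{\tau\to\infty}E(\tau,S)=0$ for each $S$,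 so $E>0$; $E_{\tau\tau}=-p_\tau>0$ and $E_{SS}\ge0$; and the forward and backward characteristic fields (speeds $u\pm c$) are genuinely nonlinear, i.e. $\tau\mapsto p(\tau,S)$ is strictly convex with $\sqrt{-p_\tau}=\rho c$ strictly increasing in $\rho$ for each $S$. **Elementary waves.** States are $(\rho,u,S)$. For a jump, $[g]=g_{\rm right}-g_{\rm left}$ and $\overline g$ is the average of the left and right values. The state ahead of a backward wave is its left state, and the state ahead of a forward wave is its right state; the other state is the behind state. - Backward rarefaction with left (ahead) state $(\rho_l,u_l,S_l)$: states $(\rho,u,S)$ with $S=S_l$, $\rho<\rho_l$, $u-u_l=R(\rho_l,S_l)-R(\rho,S_l)$. - Forward rarefaction with right (ahead) state $(\rho_r,u_r,S_r)$: states with $S=S_r$, $\rho<\rho_r$, $u_r-u=R(\rho_r,S_r)-R(\rho,S_r)$. - Backward or forward shock: $[E]+\overline p\,[\tau]=0$, $[u]=-\sqrt{-[p][\tau]}$, with pressure and density strictly larger behind than ahead. - Contact discontinuity: $[u]=0$, $[p]=0$. **Riemann problem.** The Riemann problem is the Cauchy problem with data equal to a constant state $(\rho_l,u_l,S_l)$ for $x<0$ and a constant state $(\rho_r,u_r,S_r)$ for $x>0$, with $\rho_l,\rho_r>0$. A Riemann solution without vacuum consists of two intermediate states $U_1,U_2$ of positive density such that $U_l,U_1$ are joined by a backward shock or rarefaction (or are equal), $U_1,U_2$ by a contact (or are equal), and $U_2,U_r$ by a forward shock or rarefaction (or are equal). A Riemann solution containing a vacuum consists of a backward rarefaction with left state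 $U_l$ along which $\rho$ decreases to $0$, and a forward rarefaction with right state $U_r$ along which (from right to left) $\rho$ decreases to $0$, separated by a vacuum region $\rho=0$; the velocity is required to be finite and nondecreasing in $x$, so that the limiting velocities $u_l^*$, $u_r^*$ of the two rarefactions as $\rho\to0$ are finite and satisfy $u_l\le u_l^*\le u_r^*\le u_r$. *)

theory Defs
  imports "HOL-Analysis.Analysis"
begin

subsection \<open>Smoothness and convexity\<close>

definition D1 :: "(real \<Rightarrow> real \<Rightarrow> real) \<Rightarrow> real \<Rightarrow> real \<Rightarrow> real" where
  "D1 f x y = deriv (\<lambda>t. f t y) x"

definition D2 :: "(real \<Rightarrow> real \<Rightarrow> real) \<Rightarrow> real \<Rightarrow> real \<Rightarrow> real" where
  "D2 f x y = deriv (\<lambda>t. f x t) y"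

definition C1_on :: "(real \<Rightarrow> real \<Rightarrow> real) \<Rightarrow> (real \<times> real) set \<Rightarrow> bool" where
  "C1_on f U \<longleftrightarrow>
     (\<forall>(x, y)\<in>U. (\<lambda>t. f t y) differentiable (at x) \<and> (\<lambda>t. f x t) differentiable (at y)) \<and>
     continuous_on U (\<lambda>(x, y). D1 f x y) \<and> continuous_on U (\<lambda>(x, y). D2 f x y)"

definition C2_on :: "(real \<Rightarrow> real \<Rightarrow> real) \<Rightarrow> (real \<times> real) set \<Rightarrow> bool" where
  "C2_on f U \<longleftrightarrow> C1_on f U \<and> C1_on (D1 f) U \<and> C1_on (D2 f) U"

definition strictly_convex_on :: "real set \<Rightarrow> (real \<Rightarrow> real) \<Rightarrow> bool" where
  "strictly_convex_on A f \<longleftrightarrow> convex A \<and>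
     (\<forall>x\<in>A. \<forall>y\<in>A. \<forall>t. x \<noteq> y \<longrightarrow> 0 < t \<longrightarrow> t < 1 \<longrightarrow>
        f ((1 - t) * x + t * y) < (1 - t) * f x + t * f y)"

subsection \<open>Equation of state\<close>

text \<open>An energy function \<open>E\<close> takes the specific volume \<open>\<tau>\<close> first and the specific entropy \<open>S\<close>
  second. Only its values for \<open>\<tau> > 0\<close> are meaningful.\<close>

type_synonym energy = "real \<Rightarrow> real \<Rightarrow> real"

definition pressure :: "energy \<Rightarrow> real \<Rightarrow> real \<Rightarrow> real" where
  "pressure E \<tau> S = - D1 E \<tau> S"

definition temperature :: "energy \<Rightarrow> real \<Rightarrow> real \<Rightarrow> real" where
  "temperature E \<tau> S = D2 E \<tau> S"

definition p_hat :: "energy \<Rightarrow> real \<Rightarrow> real \<Rightarrow> real" where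
  "p_hat E \<rho> S = pressure E (1 / \<rho>) S"

definition p_hat_rho :: "energy \<Rightarrow> real \<Rightarrow> real \<Rightarrow> real" where
  "p_hat_rho E \<rho> S = D1 (p_hat E) \<rho> S"

definition sound_speed :: "energy \<Rightarrow> real \<Rightarrow> real \<Rightarrow> real" where
  "sound_speed E \<rho> S = sqrt (p_hat_rho E \<rho> S)"

text \<open>The integral below is oriented: it is negative when \<open>\<rho> < 1\<close>.\<close>

definition R_fun :: "energy \<Rightarrow> real \<Rightarrow> real \<Rightarrow> real" where
  "R_fun E \<rho> S = (LBINT r=1..\<rho>. sqrt (p_hat_rho E r S) / r)"

text \<open>Positivity of \<open>E\<close> is not listed, since it follows from \<open>E_\<tau> = - p < 0\<close> and \<open>E \<rightarrow> 0\<close>.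
  In the last clause \<open>sqrt (- p_\<tau>)\<close>, taken at \<open>\<tau> = 1/\<rho>\<close>, is \<open>\<rho> c\<close>.\<close>

definition equation_of_state :: "energy \<Rightarrow> bool" where
  "equation_of_state E \<longleftrightarrow>
     C2_on E ({0<..} \<times> UNIV) \<and>
     (\<forall>\<tau>>0. \<forall>S. pressure E \<tau> S > 0) \<and>
     (\<forall>\<tau>>0. \<forall>S. temperature E \<tau> S \<ge> 0) \<and>
     (\<forall>S. ((\<lambda>\<tau>. E \<tau> S) \<longlongrightarrow> 0) at_top) \<and>
     (\<forall>\<tau>>0. \<forall>S. D1 (D1 E) \<tau> S > 0) \<and>
     (\<forall>\<tau>>0. \<forall>S. D2 (D2 E) \<tau> S \<ge> 0) \<and>
     (\<forall>S. strictly_convex_on {0<..} (\<lambda>\<tau>. pressure E \<tau> S)) \<and>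
     (\<forall>S. strict_mono_on {0<..} (\<lambda>\<rho>. sqrt (- D1 (pressure E) (1 / \<rho>) S)))"

text \<open>The pressure is positive, so finiteness of \<open>\<integral>p d\<tau>\<close> is absolute integrability. The lemma
  after the definition gives the equivalent form in the density.\<close>

definition energy_condition :: "energy \<Rightarrow> bool" where
  "energy_condition E \<longleftrightarrow> (\<forall>S. (\<lambda>\<tau>. pressure E \<tau> S) absolutely_integrable_on {1..})"

lemma energy_integral_density:
  "(\<lambda>\<tau>. pressure E \<tau> S) absolutely_integrable_on {1..} \<longleftrightarrow>
     (\<lambda>\<rho>. p_hat E \<rho> S / \<rho>\<^sup>2) absolutely_integrable_on {0<..1}" (is ?A)
  "(\<lambda>\<tau>. pressure E \<tau> S) absolutely_integrable_on {1..} \<Longrightarrow>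
     integral {1..} (\<lambda>\<tau>. pressure E \<tau> S) = integral {0<..1} (\<lambda>\<rho>. p_hat E \<rho> S / \<rho>\<^sup>2)" (is "?P \<Longrightarrow> ?B")
proof -
  have img: "(\<lambda>\<rho>::real. 1 / \<rho>) ` {0<..1} = {1..}"
  proof (intro set_eqI iffI)
    fix x :: real assume "x \<in> {1..}"
    then show "x \<in> (\<lambda>\<rho>. 1 / \<rho>) ` {0<..1}"
      by (intro image_eqI[of _ _ "1 / x"]) (auto simp: field_simps)
  qed (auto simp: field_simps)
  have der: "((\<lambda>\<rho>. 1 / \<rho>) has_field_derivative - (1 / x\<^sup>2)) (at x within {0<..1})"
    if "x \<in> {0<..1}" for x :: real
    using that by (auto intro!: derivative_eq_intros simp: power2_eq_square)
  have inj: "inj_on (\<lambda>\<rho>::real. 1 / \<rho>) {0<..1}"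
    by (auto simp: inj_on_def)
  have eq: "(\<lambda>\<rho>. \<bar>- (1 / \<rho>\<^sup>2)\<bar> * pressure E (1 / \<rho>) S) = (\<lambda>\<rho>. p_hat E \<rho> S / \<rho>\<^sup>2)"
    by (auto simp: p_hat_def)
  note cov = has_absolute_integral_change_of_variables_1'
    [of "{0<..1}" "\<lambda>\<rho>. 1 / \<rho>" "\<lambda>\<rho>. - (1 / \<rho>\<^sup>2)" "\<lambda>\<tau>. pressure E \<tau> S",
     OF _ der inj, unfolded eq img]
  show ?A using cov by auto
  show ?B if ?P using cov that by auto
qed

text \<open>In the next definition \<open>\<epsilon>\<close>, \<open>\<alpha>\<close>, \<open>M\<close> depend on the one entropy value \<open>S\<close>.\<close>

definition pressure_near_vacuum :: "energy \<Rightarrow> bool" where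
  "pressure_near_vacuum E \<longleftrightarrow>
     (\<exists>S. \<exists>\<epsilon>>0. \<exists>\<alpha>>0. \<exists>M>0. \<forall>\<rho>\<in>{0<..<\<epsilon>}. p_hat_rho E \<rho> S \<le> M * \<rho> powr \<alpha>)"

subsection \<open>Rarefactions and the vacuum Riemann solution\<close>

text \<open>A state is a triple \<open>(\<rho>, u, S)\<close>. The first state argument is the one ahead of the wave.\<close>

type_synonym state = "real \<times> real \<times> real"

definition backward_rarefaction :: "energy \<Rightarrow> state \<Rightarrow> state \<Rightarrow> bool" where
  "backward_rarefaction E = (\<lambda>(\<rho>l, ul, Sl) (\<rho>, u, S).
     0 < \<rho> \<and> S = Sl \<and> \<rho> < \<rho>l \<and> u - ul = R_fun E \<rho>l Sl - R_fun E \<rho> Sl)"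

definition forward_rarefaction :: "energy \<Rightarrow> state \<Rightarrow> state \<Rightarrow> bool" where
  "forward_rarefaction E = (\<lambda>(\<rho>r, ur, Sr) (\<rho>, u, S).
     0 < \<rho> \<and> S = Sr \<and> \<rho> < \<rho>r \<and> ur - u = R_fun E \<rho>r Sr - R_fun E \<rho> Sr)"

text \<open>Riemann solutions are functions \<open>\<rho>\<close>, \<open>u\<close>, \<open>S\<close> of the similarity variable \<open>\<xi> = x/t\<close>.
  A complete fan occupies an open interval of \<open>\<xi>\<close>, runs through the states of a rarefaction
  from the ahead state down to density \<open>0\<close>, and each of its states travels with the
  characteristic speed \<open>u - c\<close> (backward) or \<open>u + c\<close> (forward).\<close>

definition backward_fan_to_vacuum ::
  "energy \<Rightarrow> state \<Rightarrow> real \<Rightarrow> real \<Rightarrow> (real \<Rightarrow> real) \<Rightarrow> (real \<Rightarrow> real) \<Rightarrow> (real \<Rightarrow> real) \<Rightarrow> bool" where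
  "backward_fan_to_vacuum E Ul a b \<rho> u S \<longleftrightarrow> a < b \<and>
     (\<forall>\<xi>\<in>{a<..<b}. backward_rarefaction E Ul (\<rho> \<xi>, u \<xi>, S \<xi>) \<and>
        \<xi> = u \<xi> - sound_speed E (\<rho> \<xi>) (S \<xi>)) \<and>
     strict_antimono_on {a<..<b} \<rho> \<and>
     (\<rho> \<longlongrightarrow> fst Ul) (at_right a) \<and> (\<rho> \<longlongrightarrow> 0) (at_left b)"

definition forward_fan_to_vacuum ::
  "energy \<Rightarrow> state \<Rightarrow> real \<Rightarrow> real \<Rightarrow> (real \<Rightarrow> real) \<Rightarrow> (real \<Rightarrow> real) \<Rightarrow> (real \<Rightarrow> real) \<Rightarrow> bool" where
  "forward_fan_to_vacuum E Ur a b \<rho> u S \<longleftrightarrow> a < b \<and>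
     (\<forall>\<xi>\<in>{a<..<b}. forward_rarefaction E Ur (\<rho> \<xi>, u \<xi>, S \<xi>) \<and>
        \<xi> = u \<xi> + sound_speed E (\<rho> \<xi>) (S \<xi>)) \<and>
     strict_mono_on {a<..<b} \<rho> \<and>
     (\<rho> \<longlongrightarrow> 0) (at_right a) \<and> (\<rho> \<longlongrightarrow> fst Ur) (at_left b)"

text \<open>The fans occupy \<open>(a, v)\<close> and \<open>(w, b)\<close>, and the vacuum \<open>[v, w]\<close>. The numbers \<open>ul'\<close> and \<open>ur'\<close>
  are the limiting velocities \<open>u_l\<^sup>*\<close>, \<open>u_r\<^sup>*\<close>. The entropy is unconstrained in the vacuum, where it
  has no meaning.\<close>

definition vacuum_riemann_solution ::
  "energy \<Rightarrow> state \<Rightarrow> state \<Rightarrow> (real \<Rightarrow> real) \<Rightarrow> (real \<Rightarrow> real) \<Rightarrow> (real \<Rightarrow> real) \<Rightarrow> bool" where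
  "vacuum_riemann_solution E = (\<lambda>(\<rho>l, ul, Sl) (\<rho>r, ur, Sr) \<rho> u S.
     \<exists>a v w b ul' ur'. v \<le> w \<and>
       (\<forall>\<xi>\<le>a. (\<rho> \<xi>, u \<xi>, S \<xi>) = (\<rho>l, ul, Sl)) \<and>
       backward_fan_to_vacuum E (\<rho>l, ul, Sl) a v \<rho> u S \<and>
       (\<forall>\<xi>\<in>{v..w}. \<rho> \<xi> = 0) \<and>
       forward_fan_to_vacuum E (\<rho>r, ur, Sr) w b \<rho> u S \<and>
       (\<forall>\<xi>\<ge>b. (\<rho> \<xi>, u \<xi>, S \<xi>) = (\<rho>r, ur, Sr)) \<and>
       mono u \<and>
       (u \<longlongrightarrow> ul') (at_left v) \<and> (u \<longlongrightarrow> ur') (at_right w) \<and>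
       ul \<le> ul' \<and> ul' \<le> ur' \<and> ur' \<le> ur)"

end

theory Submission
  imports Defs
begin

text \<open>At the entropy \<open>S\<close> of the near-vacuum condition, \<open>R' = c / \<rho>\<close> is \<open>O(\<rho>\<^bsup>\<alpha>/2 - 1\<^esup>)\<close>, so \<open>R\<close> has
  a finite limit \<open>R\<^sub>0\<close> as \<open>\<rho> \<rightarrow> 0\<close>, and \<open>c \<rightarrow> 0\<close>. Genuine nonlinearity makes the speed function
  \<open>R + c\<close> strictly increasing in \<open>\<rho>\<close>; inverting it yields a complete fan from density \<open>1\<close> down to
  vacuum, with finite limiting velocity. This fan and its mirror image, with velocities
  \<open>\<mp>(1 - R\<^sub>0)\<close> ahead, leave the vacuum region \<open>[-1, 1]\<close> between them.\<close>

text \<open>The inverse of \<open>H\<close> is continuous because \<open>{a..b}\<close> is compact,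
  and the intermediate value theorem identifies its domain as \<open>{H a..H b}\<close>. Composing
  it with the clamp \<open>cl\<close> onto that interval extends it to the whole line by the
  constants \<open>a\<close> and \<open>b\<close>; later these constants produce the vacuum and the
  undisturbed states.\<close>

lemma clamped_inverse_exists:
  fixes H :: "real \<Rightarrow> real"
  assumes "a < b" and cont: "continuous_on {a..b} H" and mono: "strict_mono_on {a..b} H"
  obtains k where "continuous_on UNIV k" "mono k" "\<And>x. k x \<in> {a..b}"
    "\<And>x. x \<in> {H a..H b} \<Longrightarrow> H (k x) = x"
    "\<And>x. x \<le> H a \<Longrightarrow> k x = a" "\<And>x. H b \<le> x \<Longrightarrow> k x = b"
proof -
  have Hab: "H a < H b"
    using mono \<open>a < b\<close> by (auto simp: strict_mono_on_def)
  have inj: "inj_on H {a..b}"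
    using mono by (rule strict_mono_on_imp_inj_on)
  have le: "H x \<le> H y" if "a \<le> x" "x \<le> y" "y \<le> b" for x y
    using strict_mono_onD[OF mono, of x y] that by (cases "x = y") auto
  have img: "H ` {a..b} = {H a..H b}"
  proof
    show "{H a..H b} \<subseteq> H ` {a..b}"
    proof
      fix y assume "y \<in> {H a..H b}"
      then show "y \<in> H ` {a..b}"
        using IVT'[of H a y b] cont \<open>a < b\<close> by auto
    qed
  qed (use le \<open>a < b\<close> in auto)
  define g where "g = the_inv_into {a..b} H"
  define cl where "cl x = max (H a) (min (H b) x)" for x
  define k where "k = g \<circ> cl"
  have cl: "cl x \<in> H ` {a..b}" for x
    unfolding img cl_def using Hab by auto
  have gH: "g (H x) = x" if "x \<in> {a..b}" for x
    unfolding g_def using the_inv_into_f_f[OF inj that] .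
  have Hk: "H (k x) = cl x" for x
    using f_the_inv_into_f[OF inj cl] by (simp add: k_def g_def)
  have kin: "k x \<in> {a..b}" for x
    using the_inv_into_into[OF inj cl order_refl] by (simp add: k_def g_def)
  have "continuous_on {H a..H b} g"
    using continuous_on_inv[OF cont compact_Icc] gH img by auto
  moreover have "continuous_on UNIV cl"
    unfolding cl_def by (intro continuous_intros)
  ultimately have "continuous_on UNIV k"
    unfolding k_def using cl img
    by (intro continuous_on_compose) (auto elim: continuous_on_subset)
  moreover have "mono k"
  proof
    fix x y :: real assume "x \<le> y"
    then have "H (k x) \<le> H (k y)"
      unfolding Hk cl_def by auto
    then show "k x \<le> k y"
      using strict_mono_onD[OF mono, of "k y" "k x"] kin[of x] kin[of y] by fastforce
  qed
  moreover have "H (k x) = x" if "x \<in> {H a..H b}" for x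
    unfolding Hk using that by (auto simp: cl_def)
  moreover have "k x = a" if "x \<le> H a" for x
    using gH[of a] that \<open>a < b\<close> Hab by (simp add: k_def cl_def)
  moreover have "k x = b" if "H b \<le> x" for x
    using gH[of b] that \<open>a < b\<close> Hab by (simp add: k_def cl_def)
  ultimately show ?thesis
    using kin that by blast
qed

text \<open>Since \<open>f\<close> is nondecreasing, its infimum is the right limit at 0 as soon as
  \<open>f\<close> is bounded below. The lower bound comes from \<beta> > 0, which makes the power
  integrable near 0.\<close>

lemma tendsto_at_right_of_power_bound:
  fixes f f' :: "real \<Rightarrow> real"
  assumes deriv: "\<And>x. 0 < x \<Longrightarrow> (f has_real_derivative f' x) (at x)"
    and nonneg: "\<And>x. 0 < x \<Longrightarrow> 0 \<le> f' x"
    and "0 < \<epsilon>" "0 < \<beta>"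
    and bound: "\<And>x. 0 < x \<Longrightarrow> x < \<epsilon> \<Longrightarrow> f' x \<le> C * x powr (\<beta> - 1)"
  obtains l where "(f \<longlongrightarrow> l) (at_right 0)" "\<And>x. 0 < x \<Longrightarrow> l \<le> f x"
proof -
  have mono: "f x \<le> f y" if "0 < x" "x \<le> y" for x y
    using that by (intro DERIV_nonneg_imp_nondecreasing[of x y f])
      (auto intro!: exI[of _ "f' _"] deriv nonneg)
  \<comment> \<open>The subtracted term is an antiderivative of the bound, so \<open>q\<close> is
    nonincreasing on (0, \<epsilon>).\<close>
  define q where "q x = f x - C / \<beta> * x powr \<beta>" for x
  have q: "(q has_real_derivative f' x - C * x powr (\<beta> - 1)) (at x)" if "0 < x" for x
    unfolding q_def using that \<open>0 < \<beta>\<close> by (auto intro!: derivative_eq_intros deriv)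
  \<comment> \<open>A negative \<open>C\<close> would contradict \<open>0 \<le> f'\<close> at
    \<epsilon>/2. The sign is what gives \<open>q z \<le> f z\<close> below.\<close>
  have C: "0 \<le> C"
  proof -
    have "0 \<le> C * (\<epsilon>/2) powr (\<beta> - 1)"
      using nonneg[of "\<epsilon>/2"] bound[of "\<epsilon>/2"] \<open>0 < \<epsilon>\<close> by auto
    then show ?thesis
      using \<open>0 < \<epsilon>\<close> by (simp add: zero_le_mult_iff)
  qed
  have low: "q (\<epsilon>/2) \<le> f x" if "0 < x" for x
  proof -
    \<comment> \<open>The minimum keeps the comparison within the range of the bound; monotonicity
      of \<open>f\<close> covers larger \<open>x\<close>.\<close>
    define z where "z = min x (\<epsilon>/2)"
    have z: "0 < z" "z \<le> \<epsilon>/2" "z \<le> x"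
      using that \<open>0 < \<epsilon>\<close> by (auto simp: z_def)
    have "q (\<epsilon>/2) \<le> q z"
    proof (rule DERIV_nonpos_imp_nonincreasing[OF z(2)])
      fix y assume "z \<le> y" "y \<le> \<epsilon>/2"
      then show "\<exists>d. (q has_real_derivative d) (at y) \<and> d \<le> 0"
        using q[of y] bound[of y] z(1) \<open>0 < \<epsilon>\<close> by fastforce
    qed
    also have "\<dots> \<le> f z"
      unfolding q_def using C \<open>0 < \<beta>\<close> by simp
    also have "\<dots> \<le> f x"
      using mono z by auto
    finally show ?thesis .
  qed
  define l where "l = Inf (f ` {0<..})"
  have bdd: "bdd_below (f ` {0<..})"
    using low by (auto intro!: bdd_belowI)
  have l: "l \<le> f x" if "0 < x" for x
    unfolding l_def using bdd that by (auto intro: cInf_lower)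
  have "(f \<longlongrightarrow> l) (at_right 0)"
  proof (rule order_tendstoI)
    fix y assume "y < l"
    then show "\<forall>\<^sub>F x in at_right 0. y < f x"
      using l by (auto simp: eventually_at_filter intro!: always_eventually intro: less_le_trans)
  next
    fix y assume "l < y"
    then obtain x where x: "0 < x" "f x < y"
      unfolding l_def using cInf_lessD[of "f ` {0<..}" y] by fastforce
    have "f z < y" if "0 < z" "z < x" for z
      using mono[of z x] that x by auto
    then show "\<forall>\<^sub>F x in at_right 0. f x < y"
      using x by (auto simp: eventually_at_right_field)
  qed
  then show ?thesis
    using l that by blast
qed

text \<open>Chain rule for \<tau> = 1/\<rho>: the sign in p = -E_\<tau> cancels that of
  d\<tau>/d\<rho>. Positivity and continuity of the sound speed are then read off from
  E_\<tau>\<tau>.\<close>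

lemma p_hat_rho_eq:
  assumes "equation_of_state E" and "0 < \<rho>"
  shows "p_hat_rho E \<rho> S = D1 (D1 E) (1 / \<rho>) S / \<rho>\<^sup>2"
proof -
  have "(\<lambda>t. D1 E t S) differentiable at (1 / \<rho>)"
    using assms by (auto simp: equation_of_state_def C2_on_def C1_on_def)
  then have "((\<lambda>t. D1 E t S) has_real_derivative D1 (D1 E) (1 / \<rho>) S) (at (1 / \<rho>))"
    by (simp add: DERIV_deriv_iff_real_differentiable D1_def)
  moreover have "((\<lambda>r. 1 / r) has_real_derivative - (1 / \<rho>\<^sup>2)) (at \<rho>)"
    using \<open>0 < \<rho>\<close> by (auto intro!: derivative_eq_intros simp: power2_eq_square)
  ultimately have
    "((\<lambda>r. D1 E (1 / r) S) has_real_derivative D1 (D1 E) (1 / \<rho>) S * - (1 / \<rho>\<^sup>2)) (at \<rho>)"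
    by (rule DERIV_chain2)
  then have "((\<lambda>r. p_hat E r S) has_real_derivative D1 (D1 E) (1 / \<rho>) S / \<rho>\<^sup>2) (at \<rho>)"
    unfolding p_hat_def pressure_def by (auto intro!: derivative_eq_intros)
  then show ?thesis
    unfolding p_hat_rho_def D1_def[of "p_hat E"] by (rule DERIV_imp_deriv)
qed

lemma D1_pressure:
  assumes "equation_of_state E" and "0 < \<tau>"
  shows "D1 (pressure E) \<tau> S = - D1 (D1 E) \<tau> S"
proof -
  have "(\<lambda>t. D1 E t S) differentiable at \<tau>"
    using assms by (auto simp: equation_of_state_def C2_on_def C1_on_def)
  then have "((\<lambda>t. - D1 E t S) has_real_derivative - D1 (D1 E) \<tau> S) (at \<tau>)"
    by (intro DERIV_minus) (simp add: DERIV_deriv_iff_real_differentiable D1_def)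
  then show ?thesis
    unfolding pressure_def D1_def[of "\<lambda>\<tau> S. - D1 E \<tau> S"] by (rule DERIV_imp_deriv)
qed

lemma sound_speed_pos:
  assumes "equation_of_state E" and "0 < \<rho>"
  shows "0 < sound_speed E \<rho> S"
  using assms by (auto simp: sound_speed_def p_hat_rho_eq equation_of_state_def)

lemma continuous_on_sound_speed:
  assumes "equation_of_state E"
  shows "continuous_on {0<..} (\<lambda>\<rho>. sound_speed E \<rho> S)"
proof -
  have "continuous_on ({0<..} \<times> UNIV) (\<lambda>(x, y). D1 (D1 E) x y)"
    using assms by (auto simp: equation_of_state_def C2_on_def C1_on_def)
  then have "continuous_on {0<..} (\<lambda>\<rho>. (\<lambda>(x, y). D1 (D1 E) x y) (1 / \<rho>, S))"
    by (rule continuous_on_compose2) (auto intro!: continuous_intros)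
  then have "continuous_on {0<..} (\<lambda>\<rho>. sqrt (D1 (D1 E) (1 / \<rho>) S / \<rho>\<^sup>2))"
    by (auto intro!: continuous_intros)
  then show ?thesis
    by (rule continuous_on_eq) (use assms in \<open>auto simp: sound_speed_def p_hat_rho_eq\<close>)
qed

text \<open>Genuine nonlinearity expressed through c: since c^2 = E_\<tau>\<tau>/\<rho>^2, the
  product \<rho> c is sqrt(-p_\<tau>) at \<tau> = 1/\<rho>.\<close>

lemma strict_mono_on_density_times_sound_speed:
  assumes "equation_of_state E"
  shows "strict_mono_on {0<..} (\<lambda>\<rho>. \<rho> * sound_speed E \<rho> S)"
proof -
  have "sqrt (- D1 (pressure E) (1 / \<rho>) S) = \<rho> * sound_speed E \<rho> S" if "0 < \<rho>" for \<rho>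
    using that assms by (simp add: sound_speed_def p_hat_rho_eq D1_pressure real_sqrt_divide)
  moreover have "strict_mono_on {0<..} (\<lambda>\<rho>. sqrt (- D1 (pressure E) (1 / \<rho>) S))"
    using assms by (auto simp: equation_of_state_def)
  ultimately show ?thesis
    by (simp add: strict_mono_on_def)
qed

lemma R_fun_has_derivative:
  assumes "equation_of_state E" and "0 < \<rho>"
  shows "((\<lambda>r. R_fun E r S) has_real_derivative sound_speed E \<rho> S / \<rho>) (at \<rho>)"
proof -
  \<comment> \<open>The interval stays away from 0 and has both 1 and \<rho> in its interior, so the
    fundamental theorem applies for \<rho> on either side of 1 and its one-interval derivative is
    two-sided.\<close>
  define a b where "a = min 1 \<rho> / 2" and "b = max 1 \<rho> + 1"
  have ab: "0 < a" "a < 1" "1 < b" "a < \<rho>" "\<rho> < b"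
    using \<open>0 < \<rho>\<close> by (auto simp: a_def b_def)
  have "continuous_on {a..b} (\<lambda>r. sound_speed E r S / r)"
    using ab by (auto intro!: continuous_intros
        continuous_on_subset[OF continuous_on_sound_speed[OF assms(1)]])
  from interval_integral_FTC2[OF _ _ this, of 1 \<rho>]
  have "((\<lambda>r. R_fun E r S) has_vector_derivative sound_speed E \<rho> S / \<rho>) (at \<rho> within {a..b})"
    using ab unfolding R_fun_def sound_speed_def by (simp add: one_ereal_def)
  then show ?thesis
    using ab by (simp add: has_real_derivative_iff_has_vector_derivative at_within_Icc_at)
qed

text \<open>For \<open>x < y\<close> both differences are compared with the constant value \<open>x c(x)\<close> of \<open>\<rho> c\<close>. This
  replaces the identity \<open>(R + c)' = (\<rho> c)' / \<rho>\<close>, as \<open>c\<close> is only continuous.\<close>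

lemma strict_mono_on_R_fun_plus_sound_speed:
  assumes "equation_of_state E"
  shows "strict_mono_on {0<..} (\<lambda>\<rho>. R_fun E \<rho> S + sound_speed E \<rho> S)"
proof (rule strict_mono_onI)
  fix x y :: real assume "x \<in> {0<..}" "y \<in> {0<..}" "x < y"
  then have xy: "0 < x" "0 < y" "x < y" by auto
  define K where "K = x * sound_speed E x S"
  have K: "K < z * sound_speed E z S" if "x < z" for z
    using strict_mono_onD[OF strict_mono_on_density_times_sound_speed[OF assms], of x z S] that xy
    by (simp add: K_def)
  have "R_fun E x S + K / x \<le> R_fun E y S + K / y"
  proof (rule DERIV_nonneg_imp_nondecreasing[where f = "\<lambda>r. R_fun E r S + K / r"])
    fix z assume z: "x \<le> z" "z \<le> y"
    with xy have "0 < z" by simp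
    have "K \<le> z * sound_speed E z S"
      using K[of z] z by (cases "x = z") (auto simp: K_def)
    then have "0 \<le> sound_speed E z S / z - K / z\<^sup>2"
      using \<open>0 < z\<close> by (simp add: field_simps power2_eq_square)
    moreover have "((\<lambda>r. R_fun E r S + K / r) has_real_derivative
        sound_speed E z S / z - K / z\<^sup>2) (at z)"
      using \<open>0 < z\<close> by (auto intro!: derivative_eq_intros R_fun_has_derivative assms
          simp: power2_eq_square)
    ultimately show "\<exists>d. ((\<lambda>r. R_fun E r S + K / r) has_real_derivative d) (at z) \<and> 0 \<le> d"
      by blast
  qed (use xy in simp)
  \<comment> \<open>Strictness enters here; the comparison of \<open>R_fun E r S + K / r\<close> at
    \<open>x\<close> and \<open>y\<close> is only weak.\<close>
  moreover have "K / y < sound_speed E y S"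
    using K[OF xy(3)] xy by (simp add: field_simps)
  moreover have "K / x = sound_speed E x S"
    using xy by (simp add: K_def)
  ultimately show "R_fun E x S + sound_speed E x S < R_fun E y S + sound_speed E y S"
    by linarith
qed

lemma sound_speed_le_powr:
  assumes "0 < \<rho>" "p_hat_rho E \<rho> S \<le> M * \<rho> powr \<alpha>"
  shows "sound_speed E \<rho> S \<le> sqrt M * \<rho> powr (\<alpha> / 2)"
proof -
  have "sqrt (\<rho> powr \<alpha>) = \<rho> powr (\<alpha> / 2)"
    using assms by (simp add: powr_half_sqrt[symmetric] powr_powr)
  then show ?thesis
    unfolding sound_speed_def using real_sqrt_le_mono[OF assms(2)] by (simp add: real_sqrt_mult)
qed

theorem theorem3p2:
  fixes E :: energy
  assumes "equation_of_state E"
    and "energy_condition E"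
    and "pressure_near_vacuum E"
  shows "\<exists>\<rho>l ul Sl \<rho>r ur Sr. 0 < \<rho>l \<and> 0 < \<rho>r \<and>
    (\<exists>\<rho> u S. vacuum_riemann_solution E (\<rho>l, ul, Sl) (\<rho>r, ur, Sr) \<rho> u S)"
proof -
  note eos = assms(1)

  \<comment> \<open>Limits of \<open>R\<close> and \<open>c\<close> at vacuum\<close>
  obtain S \<epsilon> \<alpha> M where pos: "0 < \<epsilon>" "0 < \<alpha>" "0 < M"
    and vac: "\<And>\<rho>. 0 < \<rho> \<Longrightarrow> \<rho> < \<epsilon> \<Longrightarrow> p_hat_rho E \<rho> S \<le> M * \<rho> powr \<alpha>"
    using assms(3) unfolding pressure_near_vacuum_def by force
  define c where "c \<rho> = sound_speed E \<rho> S" for \<rho>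
  define R where "R \<rho> = R_fun E \<rho> S" for \<rho>
  have c_pos: "0 < c \<rho>" if "0 < \<rho>" for \<rho>
    using sound_speed_pos[OF eos that] by (simp add: c_def)
  have c_le: "c \<rho> \<le> sqrt M * \<rho> powr (\<alpha> / 2)" if "0 < \<rho>" "\<rho> < \<epsilon>" for \<rho>
    unfolding c_def using sound_speed_le_powr vac that by blast
  have R_deriv: "(R has_real_derivative c \<rho> / \<rho>) (at \<rho>)" if "0 < \<rho>" for \<rho>
    using R_fun_has_derivative[OF eos that] unfolding R_def c_def .
  have R1: "R 1 = 0"
    by (simp add: R_def R_fun_def one_ereal_def)
  \<comment> \<open>With \<beta> = \<alpha>/2 this is the bound on \<open>R'\<close> required by
    \<open>tendsto_at_right_of_power_bound\<close>.\<close>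
  have "c \<rho> / \<rho> \<le> sqrt M * \<rho> powr (\<alpha> / 2 - 1)" if "0 < \<rho>" "\<rho> < \<epsilon>" for \<rho>
    using c_le[OF that] that by (simp add: powr_diff divide_right_mono)
  with tendsto_at_right_of_power_bound[OF R_deriv, of \<epsilon> "\<alpha> / 2" "sqrt M"] pos c_pos
  obtain R0 where R0: "(R \<longlongrightarrow> R0) (at_right 0)" and R0_le: "\<And>\<rho>. 0 < \<rho> \<Longrightarrow> R0 \<le> R \<rho>"
    by (metis divide_nonneg_pos half_gt_zero less_imp_le)
  have c0: "(c \<longlongrightarrow> 0) (at_right 0)"
  proof (rule tendsto_sandwich)
    show "\<forall>\<^sub>F \<rho> in at_right 0. 0 \<le> c \<rho>"
      using c_pos by (auto simp: eventually_at_right_field less_imp_le intro!: exI[of _ 1])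
    show "\<forall>\<^sub>F \<rho> in at_right 0. c \<rho> \<le> sqrt M * \<rho> powr (\<alpha> / 2)"
      using c_le pos by (auto simp: eventually_at_right_field)
    have "((\<lambda>\<rho>. \<rho> powr (\<alpha> / 2)) \<longlongrightarrow> 0) (at_right 0)"
      by (rule tendsto_zero_powrI[where b = "\<alpha> / 2"])
        (use pos in \<open>auto intro!: tendsto_intros simp: eventually_at_right_field\<close>)
    then show "((\<lambda>\<rho>. sqrt M * \<rho> powr (\<alpha> / 2)) \<longlongrightarrow> 0) (at_right 0)"
      by (rule tendsto_mult_right_zero)
  qed simp

  \<comment> \<open>The speed function \<open>R + c\<close> and its clamped inverse\<close>
  have h_mono: "R x + c x < R y + c y" if "0 < x" "x < y" for x y
    using strict_mono_onD[OF strict_mono_on_R_fun_plus_sound_speed[OF eos], of x y S] that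
    unfolding R_def c_def by auto
  have h_cont: "continuous_on {0<..} (\<lambda>\<rho>. R \<rho> + c \<rho>)"
  proof (rule continuous_on_add)
    show "continuous_on {0<..} R"
      using R_deriv by (intro continuous_at_imp_continuous_on) (auto intro: DERIV_isCont)
  qed (use continuous_on_sound_speed[OF eos] in \<open>simp add: c_def\<close>)
  \<comment> \<open>The value at 0 is the limit of \<open>R + c\<close>, as \<open>c\<close> tends
    to 0 there. Continuity on the closed interval lets the inverse reach density 0.\<close>
  define H where "H \<rho> = (if \<rho> = 0 then R0 else R \<rho> + c \<rho>)" for \<rho>
  have H_cont: "continuous_on {0..1} H"
    unfolding continuous_on_def
  proof
    fix x :: real assume x: "x \<in> {0..1}"
    show "(H \<longlongrightarrow> H x) (at x within {0..1})"
    proof (cases "x = 0")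
      case True
      have "((\<lambda>\<rho>. R \<rho> + c \<rho>) \<longlongrightarrow> R0 + 0) (at_right 0)"
        by (intro tendsto_add R0 c0)
      then have "(H \<longlongrightarrow> R0) (at_right 0)"
        unfolding add_0_right by (rule Lim_transform_eventually)
          (auto simp: H_def eventually_at_right_field intro!: exI[of _ 1])
      then show ?thesis
        using True by (simp add: H_def at_within_Icc_at_right)
    next
      case False
      with x have "0 < x" by auto
      have "((\<lambda>\<rho>. R \<rho> + c \<rho>) \<longlongrightarrow> R x + c x) (at x)"
        using h_cont \<open>0 < x\<close> by (simp add: continuous_on_eq_continuous_at isCont_def)
      then have "(H \<longlongrightarrow> R x + c x) (at x)"
        by (rule Lim_transform_within_open[OF _ open_greaterThan]) (use \<open>0 < x\<close> in \<open>auto simp: H_def\<close>)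
      then show ?thesis
        using \<open>0 < x\<close> by (auto simp: H_def intro: tendsto_within_subset)
    qed
  qed
  \<comment> \<open>At \<open>x = 0\<close> strictness rests on \<open>R0 \<le> R y\<close> together
    with \<open>0 < c y\<close>.\<close>
  have H_mono: "strict_mono_on {0..1} H"
  proof (rule strict_mono_onI)
    fix x y :: real assume "x \<in> {0..1}" "y \<in> {0..1}" "x < y"
    then show "H x < H y"
      using h_mono[of x y] R0_le[of y] c_pos[of y] by (cases "x = 0") (auto simp: H_def)
  qed
  obtain k where k_cont: "continuous_on UNIV k" and k_mono: "mono k"
    and k_in: "\<And>x. k x \<in> {0..1}" and Hk: "\<And>x. x \<in> {H 0..H 1} \<Longrightarrow> H (k x) = x"
    and k0: "\<And>x. x \<le> H 0 \<Longrightarrow> k x = 0" and k1: "\<And>x. H 1 \<le> x \<Longrightarrow> k x = 1"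
    using clamped_inverse_exists[OF zero_less_one H_cont H_mono] by blast
  define h1 where "h1 = c 1"
  have H0: "H 0 = R0" and H1: "H 1 = h1"
    by (auto simp: H_def h1_def R1)
  have h1: "R0 < h1"
    using R0_le[of 1] c_pos[of 1] R1 by (simp add: h1_def)
  have k_pos: "0 < k x" if "R0 < x" for x
  proof (cases "x \<le> h1")
    case True
    then show ?thesis
      using Hk[of x] that k_in[of x] H0 H1 by (cases "k x = 0") auto
  qed (use k1 H1 in auto)
  have k_less_1: "k x < 1" if "x < h1" for x
  proof (cases "R0 \<le> x")
    case True
    then show ?thesis
      using Hk[of x] that k_in[of x] H0 H1 by (cases "k x = 1") auto
  qed (use k0 H0 in auto)
  have k_inv: "R (k x) + c (k x) = x" if "R0 < x" "x < h1" for x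
    using Hk[of x] k_pos[of x] that H0 H1 by (simp add: H_def)
  \<comment> \<open>Equal values of \<open>k\<close> would give equal speeds by
    \<open>k_inv\<close>, so weak monotonicity becomes strict between the clamping values.\<close>
  have k_strict: "k x < k y" if "R0 < x" "x < y" "y < h1" for x y
    using k_inv[of x] k_inv[of y] monoD[OF k_mono, of x y] that by (cases "k x = k y") auto
  have R_mono: "R x \<le> R y" if "0 < x" "x \<le> y" for x y
  proof (rule DERIV_nonneg_imp_nondecreasing[OF that(2)])
    fix z assume "x \<le> z"
    with \<open>0 < x\<close> have "0 < z" by simp
    then show "\<exists>d. (R has_real_derivative d) (at z) \<and> 0 \<le> d"
      using R_deriv[of z] c_pos[of z] by (auto intro!: exI[of _ "c z / z"])
  qed

  \<comment> \<open>Density and velocity as functions of \<xi>\<close>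
  \<comment> \<open>In the forward fan u = 1 - R0 + R(\<rho>), so \<xi> = u + c reads R + c = \<xi>
    - 1 + R0, which \<open>k\<close> solves for \<rho>. The shift puts the vacuum edge at \<xi> = 1,
    where R + c tends to R0; the absolute value mirrors the fan.\<close>
  define \<rho> where "\<rho> \<xi> = k (\<bar>\<xi>\<bar> - 1 + R0)" for \<xi>
  \<comment> \<open>Inside the vacuum, u = \<xi> joins the limiting velocities -1 and 1
    monotonically. In the constant states \<rho> = 1 and \<open>R 1 = 0\<close>, so the outer
    formula gives the data velocities.\<close>
  define u where "u \<xi> = (if \<bar>\<xi>\<bar> \<le> 1 then \<xi> else sgn \<xi> * (1 - R0 + R (\<rho> \<xi>)))" for \<xi>
  \<comment> \<open>The outer edge of the forward fan: velocity 1 - R0 plus sound speed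
    \<open>c 1\<close>.\<close>
  define b where "b = 1 - R0 + h1"
  have b: "1 < b"
    using h1 by (simp add: b_def)
  have \<rho>_cont: "isCont \<rho> \<xi>" for \<xi>
  proof -
    have "continuous_on UNIV \<rho>"
      unfolding \<rho>_def by (intro continuous_on_compose2[OF k_cont] continuous_intros) auto
    then show ?thesis
      by (simp add: continuous_on_eq_continuous_at)
  qed
  have \<rho>_uminus: "\<rho> (- \<xi>) = \<rho> \<xi>" for \<xi>
    by (simp add: \<rho>_def)
  have u_uminus: "u (- \<xi>) = - u \<xi>" for \<xi>
    by (simp add: u_def \<rho>_uminus sgn_minus)
  have \<rho>_pos: "0 < \<rho> \<xi>" if "1 < \<xi>" for \<xi>
    unfolding \<rho>_def using that by (intro k_pos) auto
  have \<rho>0: "\<rho> \<xi> = 0" if "\<bar>\<xi>\<bar> \<le> 1" for \<xi>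
    using that k0 H0 by (simp add: \<rho>_def)
  have \<rho>1: "\<rho> \<xi> = 1" if "b \<le> \<bar>\<xi>\<bar>" for \<xi>
    using that k1 H1 by (simp add: \<rho>_def b_def)
  have u_right: "u \<xi> = 1 - R0 + R (\<rho> \<xi>)" if "1 < \<xi>" for \<xi>
    using that by (simp add: u_def)
  have fan: "0 < \<rho> \<xi>" "\<rho> \<xi> < 1" "u \<xi> = 1 - R0 + R (\<rho> \<xi>)" "\<xi> = u \<xi> + c (\<rho> \<xi>)"
    if "1 < \<xi>" "\<xi> < b" for \<xi>
  proof -
    show "0 < \<rho> \<xi>" "u \<xi> = 1 - R0 + R (\<rho> \<xi>)"
      using \<rho>_pos u_right that by auto
    show "\<rho> \<xi> < 1"
      unfolding \<rho>_def using that by (intro k_less_1) (auto simp: b_def)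
    show "\<xi> = u \<xi> + c (\<rho> \<xi>)"
      using that k_inv[of "\<xi> - 1 + R0"] u_right by (simp add: \<rho>_def b_def)
  qed
  have \<rho>_strict: "\<rho> x < \<rho> y" if "1 < x" "x < y" "y < b" for x y
    unfolding \<rho>_def using that by (intro k_strict) (auto simp: b_def)
  have u_far: "u \<xi> = 1 - R0" if "b \<le> \<xi>" for \<xi>
    using that b u_right[of \<xi>] \<rho>1[of \<xi>] R1 by simp

  \<comment> \<open>Monotonicity and edge limits of the velocity\<close>
  have u_ge: "1 \<le> u \<xi>" if "1 < \<xi>" for \<xi>
    using R0_le[OF \<rho>_pos[OF that]] u_right[OF that] by simp
  have u_mono: "u x \<le> u y" if "1 < x" "x \<le> y" for x y
    using that u_right[of x] u_right[of y] \<rho>_pos[of x]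
    by (auto intro!: R_mono simp: \<rho>_def monoD[OF k_mono])
  have mono: "mono u"
  proof
    fix x y :: real assume xy: "x \<le> y"
    have mid: "u \<xi> = \<xi>" if "\<bar>\<xi>\<bar> \<le> 1" for \<xi>
      using that by (simp add: u_def)
    have left: "u \<xi> \<le> - 1" if "\<xi> < - 1" for \<xi>
      using u_ge[of "- \<xi>"] u_uminus[of \<xi>] that by simp
    \<comment> \<open>The first two cases lie on one side and its mirror image. In the others, a
      value between \<open>u x\<close> and \<open>u y\<close> (-1 or 1) separates them, unless both
      arguments lie in the vacuum, where \<open>u\<close> is the identity.\<close>
    consider "1 < x" | "y < - 1" | "x < - 1" "- 1 \<le> y" | "- 1 \<le> x" "x \<le> 1"
      by linarith
    then show "u x \<le> u y"
    proof cases
      case 1 then show ?thesis using u_mono xy by simp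
    next
      case 2 then show ?thesis using u_mono[of "- y" "- x"] xy u_uminus by simp
    next
      case 3 then show ?thesis using left[of x] u_ge[of y] mid[of y] by fastforce
    next
      case 4 then show ?thesis using xy mid[of x] u_ge[of y] mid[of y] by fastforce
    qed
  qed
  have u_lim: "(u \<longlongrightarrow> 1) (at_right 1)"
  proof -
    have "(\<rho> \<longlongrightarrow> 0) (at_right 1)"
      using \<rho>_cont[of 1] \<rho>0[of 1] by (auto simp: isCont_def intro: tendsto_within_subset)
    \<comment> \<open>The limit \<open>R0\<close> is one-sided, so \<rho> must approach 0 through
      positive values.\<close>
    moreover have "\<forall>\<^sub>F \<xi> in at_right 1. 0 < \<rho> \<xi>"
      using \<rho>_pos by (auto simp: eventually_at_right_field intro!: exI[of _ 2])
    ultimately have "filterlim \<rho> (at_right 0) (at_right 1)"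
      by (auto simp: filterlim_at elim: eventually_mono)
    then have "((\<lambda>\<xi>. 1 - R0 + R (\<rho> \<xi>)) \<longlongrightarrow> 1 - R0 + R0) (at_right 1)"
      by (intro tendsto_intros filterlim_compose[OF R0])
    then have "((\<lambda>\<xi>. 1 - R0 + R (\<rho> \<xi>)) \<longlongrightarrow> 1) (at_right 1)"
      by simp
    then show ?thesis
      by (rule Lim_transform_eventually)
        (auto simp: eventually_at_right_field u_right intro!: exI[of _ 2])
  qed
  have u_lim': "(u \<longlongrightarrow> - 1) (at_left (- 1))"
    using tendsto_minus[OF u_lim] by (simp add: filterlim_at_left_to_right u_uminus)

  \<comment> \<open>Assembly of the two fans and the vacuum\<close>
  have \<rho>_lim: "(\<rho> \<longlongrightarrow> \<rho> \<xi>) (at \<xi> within A)" for \<xi> A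
    using \<rho>_cont[of \<xi>] by (auto simp: isCont_def intro: tendsto_within_subset)
  have forward: "forward_fan_to_vacuum E (1, 1 - R0, S) 1 b \<rho> u (\<lambda>_. S)"
    unfolding forward_fan_to_vacuum_def forward_rarefaction_def
    using b fan \<rho>_strict R1 \<rho>_lim[of 1] \<rho>_lim[of b] \<rho>0[of 1] \<rho>1[of b]
    by (auto simp: strict_mono_on_def R_def c_def)
  \<comment> \<open>The reflection of \<xi> and u turns \<xi> = u + c into \<xi> = u - c and
    reverses the order of the densities.\<close>
  have fan': "0 < \<rho> \<xi>" "\<rho> \<xi> < 1" "u \<xi> = R0 - 1 - R (\<rho> \<xi>)" "\<xi> = u \<xi> - c (\<rho> \<xi>)"
    if "- b < \<xi>" "\<xi> < - 1" for \<xi>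
    using fan[of "- \<xi>"] that by (auto simp: \<rho>_uminus u_uminus)
  have \<rho>_strict': "\<rho> y < \<rho> x" if "- b < x" "x < y" "y < - 1" for x y
    using \<rho>_strict[of "- y" "- x"] that by (simp add: \<rho>_uminus)
  have backward: "backward_fan_to_vacuum E (1, R0 - 1, S) (- b) (- 1) \<rho> u (\<lambda>_. S)"
    unfolding backward_fan_to_vacuum_def backward_rarefaction_def
    using b fan' \<rho>_strict' R1 \<rho>_lim[of "- 1"] \<rho>_lim[of "- b"] \<rho>0[of "- 1"] \<rho>1[of "- b"]
    by (auto simp: monotone_on_def R_def c_def)
  have "vacuum_riemann_solution E (1, R0 - 1, S) (1, 1 - R0, S) \<rho> u (\<lambda>_. S)"
    unfolding vacuum_riemann_solution_def prod.case
  \<comment> \<open>The witnesses are the four edges \<open>a\<close>, \<open>v\<close>,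
    \<open>w\<close>, \<open>b\<close> of the fans, followed by the limiting velocities
    \<open>ul'\<close> and \<open>ur'\<close>, which here equal the vacuum edges.\<close>
  proof (rule exI[of _ "- b"], rule exI[of _ "- 1"], rule exI[of _ 1], rule exI[of _ b],
      rule exI[of _ "- 1"], rule exI[of _ 1], intro conjI)
    show "\<forall>\<xi>\<le>- b. (\<rho> \<xi>, u \<xi>, S) = (1, R0 - 1, S)"
    proof (intro allI impI)
      fix \<xi> assume "\<xi> \<le> - b"
      then show "(\<rho> \<xi>, u \<xi>, S) = (1, R0 - 1, S)"
        using \<rho>1[of \<xi>] u_far[of "- \<xi>"] u_uminus[of \<xi>] b by simp
    qed
    show "\<forall>\<xi>\<ge>b. (\<rho> \<xi>, u \<xi>, S) = (1, 1 - R0, S)"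
      using \<rho>1 u_far b by auto
    \<comment> \<open>Both inequalities amount to \<open>R0 \<le> R 1 = 0\<close>.\<close>
    show "R0 - 1 \<le> - 1" "1 \<le> 1 - R0"
      using R0_le[of 1] R1 by auto
  qed (use forward backward mono u_lim u_lim' \<rho>0 in auto)
  then show ?thesis
    using zero_less_one by blast
qed

end
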